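(* Let $F$ be the distribution function of a random variable $W$ taking values in $(0,\infty)$, and let $NR_n(\mathbf{w})$ be the Norros–Reittu random graph with weights $w_j=[1-F]^{-1}(j/n)$, $j\in[n]$. Suppose that there exist constants $c_F>0$ and $\tau>4$ such that $1-F(x)\leq c_Fx^{-(\tau-1)}$ for all $x>0$, and that the model is critical, i.e. $\nu=\mathbb{E}(W^2)/\mathbb{E}(W)=1$. Then there is a finite positive constant $c_3$, depending solely on $c_F$ and $\tau$, such that, given any $A>1$, when $n$ is large enough, $$\mathbb{P}\left(|\mathcal{C}_{\max}|>\lceil An^{2/3}\rceil\right)\leq\frac{c_3}{A^{3/2}}.$$
   Context: Notation: $[n]=\{1,\dots,n\}$. For a distribution function $F:(0,\infty)\to[0,1]$, define $[1-F]^{-1}(u)=\inf\{s:1-F(s)\leq u\}$ for $u\in(0,1)$, and set $[1-F]^{-1}(1)=0$ by convention. Given weights $\mathbf{w}=(w_i)_{i\in[n]}$ with $l_n=\sum_{i\in[n]}w_i$, the Norros–Reittu random graph $NR_n(\mathbf{w})$ is the random graph on $[n]$ in which, independently for each pair $1\leq i<j\leq n$, the edge $\{i,j\}$ is present with probability $1-e^{-w_iw_j/l_n}$. $\mathcal{C}_{\max}$ is a connected component of $NR_n(\mathbf{w})$ with the maximal number of vertices and $|\mathcal{C}_{\max}|$ is its number of vertices. *)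

theory Defs
  imports "HOL-Probability.Probability" "HOL-Probability.Product_PMF"
begin

text \<open>
  The generalised inverse of \<open>1 - F\<close> on \<open>(0,1]\<close>. Distribution functions are total functions on
  the reals here, so the infimum is restricted explicitly to the domain \<open>(0,\<infinity>)\<close> of \<open>F\<close>; the
  value at \<open>1\<close> is a convention.
\<close>

definition tail_inverse :: "(real \<Rightarrow> real) \<Rightarrow> real \<Rightarrow> real" where
  "tail_inverse F u = (if u = 1 then 0 else Inf {s. 0 < s \<and> 1 - F s \<le> u})"

definition quantile_weight :: "(real \<Rightarrow> real) \<Rightarrow> nat \<Rightarrow> nat \<Rightarrow> real" where
  "quantile_weight F n j = tail_inverse F (real j / real n)"

text \<open>
  A graph on \<open>{1..n}\<close> is represented by its set of edges, each edge being a two-element set.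
  Every pair \<open>i < j\<close> carries an independent coin deciding whether \<open>{i, j}\<close> is an edge.
\<close>

definition vertex_pairs :: "nat \<Rightarrow> (nat \<times> nat) set" where
  "vertex_pairs n = {(i, j). 1 \<le> i \<and> i < j \<and> j \<le> n}"

definition norros_reittu :: "nat \<Rightarrow> (nat \<Rightarrow> real) \<Rightarrow> nat set set pmf" where
  "norros_reittu n w =
     map_pmf (\<lambda>present. {{i, j} | i j. (i, j) \<in> vertex_pairs n \<and> present (i, j)})
       (Pi_pmf (vertex_pairs n) False
          (\<lambda>(i, j). bernoulli_pmf (1 - exp (- (w i * w j / (\<Sum>k = 1..n. w k))))))"

definition component :: "'a set \<Rightarrow> 'a set set \<Rightarrow> 'a \<Rightarrow> 'a set" where
  "component V E x = {y \<in> V. (x, y) \<in> {(a, b). {a, b} \<in> E}\<^sup>*}"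

text \<open>Only meaningful for finite nonempty \<open>V\<close>.\<close>

definition max_component_size :: "'a set \<Rightarrow> 'a set set \<Rightarrow> nat" where
  "max_component_size V E = Max ((\<lambda>x. card (component V E x)) ` V)"

end

theory Submission
  imports Defs "HOL-Real_Asymp.Real_Asymp"
begin

text \<open>
  If more than \<open>k\<close> vertices form a component, then more than \<open>k\<close> vertices have a component of size
  above \<open>k\<close>. By Markov's inequality it is therefore enough to show that a vertex \<open>v\<close> has
  \<open>P(|C(v)| > k) = O((1 + w v) / sqrt k)\<close>: summing over \<open>v\<close> and dividing by \<open>k\<close> gives
  \<open>O(n / k powr (3/2))\<close>, which is \<open>O(1 / A powr (3/2))\<close> for \<open>k = A * n powr (2/3)\<close>.

  The one-vertex bound comes from the Laplace transform \<open>E (exp (- h * |C(v)|))\<close> at \<open>h = 1/k\<close>.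
  Exposing the edges of one vertex at a time shows that this transform is at least \<open>y v\<close> for every
  \<open>y\<close> with values in \<open>[0,1]\<close> satisfying \<open>y u \<le> exp (- h) * (\<Prod>x. 1 - p u x * (1 - y x))\<close>
  (\<open>prod_le_exploration_laplace\<close>). This plays the part of the usual comparison with a branching
  process: with equality, the condition is the equation for the Laplace transforms of its total
  progenies. For the rank-one edge probabilities \<open>y u = exp (- h - \<rho> * w u)\<close> qualifies as soon as
  \<open>(\<Sum>j. w j * (1 - exp (- h - \<rho> * w j))) \<le> \<rho> * l\<close> with \<open>l = (\<Sum>j. w j)\<close>. To second order, the
  left-hand side divided by \<open>l\<close> is at most \<open>h + \<nu> * \<rho> - \<rho>\<^sup>2 / 4\<close>, where \<open>\<nu> = (\<Sum>j. (w j)\<^sup>2) / l\<close>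
  is close to \<open>1\<close>; so \<open>\<rho>\<close> of order \<open>sqrt h\<close> works if \<open>\<nu> - 1\<close> is small compared with \<open>sqrt h\<close>
  (\<open>near_critical_subsolution\<close>).

  What remains is about the weights. Write \<open>m = E W = E W\<^sup>2\<close>; then \<open>0 < m \<le> 1\<close>. A layer-cake
  comparison of the weights with \<open>W\<close> gives \<open>l \<le> n * m\<close>, \<open>(\<Sum>j. (w j)\<^sup>2) \<le> n * m\<close> and
  \<open>l \<ge> n * m - O(sqrt n)\<close>. Hence \<open>\<nu> - 1\<close> is at most of order \<open>n powr (- 1/2)\<close>, negligible against
  \<open>sqrt h\<close>, which is of order \<open>n powr (- 1/3)\<close>. The tail bound controls the largest weight: it is
  \<open>O(n powr (1 / (\<tau> - 1)))\<close>, of smaller order than \<open>n powr (1/3)\<close> because \<open>\<tau> > 4\<close>, so that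
  \<open>\<rho> * w j \<le> 1\<close> and the second-order expansion is legitimate at every vertex.
\<close>

section \<open>Exploring a random graph vertex by vertex\<close>

text \<open>
  The vertices reached from \<open>N\<close> along edges that stay in \<open>S\<close>. Several starting vertices are
  allowed because exploring a vertex replaces it by its neighbours.
\<close>
inductive_set cluster :: "('a \<Rightarrow> 'a \<Rightarrow> bool) \<Rightarrow> 'a set \<Rightarrow> 'a set \<Rightarrow> 'a set"
  for adj S N where
    seed: "x \<in> N \<Longrightarrow> x \<in> cluster adj S N"
  | step: "x \<in> cluster adj S N \<Longrightarrow> y \<in> S \<Longrightarrow> adj x y \<Longrightarrow> y \<in> cluster adj S N"

lemma cluster_subset:
  assumes "N \<subseteq> S"
  shows "cluster adj S N \<subseteq> S"
proof
  fix x assume "x \<in> cluster adj S N"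
  then show "x \<in> S" using assms by induction auto
qed

lemma cluster_empty: "cluster adj S {} = {}"
proof -
  have "x \<in> cluster adj S {} \<Longrightarrow> False" for x
    by (induction rule: cluster.induct) auto
  then show ?thesis by auto
qed

lemma cluster_cong:
  assumes "N \<subseteq> S" and "\<And>x y. x \<in> S \<Longrightarrow> y \<in> S \<Longrightarrow> adj x y = adj' x y"
  shows "cluster adj S N = cluster adj' S N"
proof -
  have *: "cluster a S N \<subseteq> cluster b S N" if "\<And>x y. x \<in> S \<Longrightarrow> y \<in> S \<Longrightarrow> a x y = b x y" for a b
  proof
    fix x assume "x \<in> cluster a S N"
    then show "x \<in> cluster b S N"
    proof induction
      case (step x y)
      then show ?case
        using that cluster_subset[OF assms(1), of a] cluster.step[of x b S N y] by blast
    qed (rule cluster.seed)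
  qed
  show ?thesis
    using *[of adj adj'] *[of adj' adj] assms(2) by blast
qed

text \<open>
  One exploration step: \<open>v\<close> is removed from the graph and its neighbours become starting
  points. The right-hand side contains \<open>N\<close> and is closed under edges inside \<open>S\<close>.
\<close>
lemma cluster_peel:
  assumes "v \<in> N"
  shows "cluster adj S N
    \<subseteq> insert v (cluster adj (S - {v}) (N - {v} \<union> {x \<in> S - {v}. adj v x}))"
proof
  fix x assume "x \<in> cluster adj S N"
  then show "x \<in> insert v (cluster adj (S - {v}) (N - {v} \<union> {x \<in> S - {v}. adj v x}))"
  proof induction
    case (seed x)
    then show ?case by (auto intro: cluster.seed)
  next
    case (step x y)
    show ?case
    proof (cases "x = v \<or> y = v")
      case True
      then show ?thesis using step by (auto intro: cluster.seed)
    next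
      case False
      then show ?thesis using step cluster.step[of x adj "S - {v}" _ y] by blast
    qed
  qed
qed

lemma card_cluster_peel:
  assumes "finite S" "N \<subseteq> S" "v \<in> N"
  shows "card (cluster adj S N)
    \<le> Suc (card (cluster adj (S - {v}) (N - {v} \<union> {x \<in> S - {v}. adj v x})))"
proof -
  let ?C = "cluster adj (S - {v}) (N - {v} \<union> {x \<in> S - {v}. adj v x})"
  have "?C \<subseteq> S - {v}"
    using assms(2) by (intro cluster_subset) auto
  then have "finite ?C"
    using assms(1) finite_subset by blast
  then have "card (cluster adj S N) \<le> card (insert v ?C)"
    using cluster_peel[OF assms(3)] by (intro card_mono) auto
  also have "\<dots> \<le> Suc (card ?C)"
    by (rule card_insert_le_m1[THEN order_trans]) auto
  finally show ?thesis .
qed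

definition ordered_pair :: "'a \<Rightarrow> 'a \<Rightarrow> 'a \<times> 'a::linorder" where
  "ordered_pair x y = (min x y, max x y)"

definition ordered_pairs :: "'a::linorder set \<Rightarrow> ('a \<times> 'a) set" where
  "ordered_pairs S = {(i, j). i \<in> S \<and> j \<in> S \<and> i < j}"

lemma inj_ordered_pair: "inj (ordered_pair v)"
  by (rule injI) (auto simp: ordered_pair_def min_def max_def split: if_splits)

lemma finite_ordered_pairs: "finite S \<Longrightarrow> finite (ordered_pairs S)"
  by (rule finite_subset[of _ "S \<times> S"]) (auto simp: ordered_pairs_def)

text \<open>
  The coins at \<open>v\<close> and the coins of the graph without \<open>v\<close> are disjoint sets of coins; the
  exploration of \<open>v\<close> uses the former and leaves the latter untouched.
\<close>
lemma ordered_pairs_split: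
  assumes "v \<in> S"
  shows "ordered_pairs S = ordered_pair v ` (S - {v}) \<union> ordered_pairs (S - {v})"
proof (intro equalityI subsetI)
  fix e assume "e \<in> ordered_pairs S"
  then obtain i j where e: "e = (i, j)" "i \<in> S" "j \<in> S" "i < j"
    by (auto simp: ordered_pairs_def)
  consider "i = v" | "j = v" | "i \<noteq> v" "j \<noteq> v" by blast
  then show "e \<in> ordered_pair v ` (S - {v}) \<union> ordered_pairs (S - {v})"
  proof cases
    case 1
    then have "e = ordered_pair v j" "j \<in> S - {v}" using e by (auto simp: ordered_pair_def)
    then show ?thesis by blast
  next
    case 2
    then have "e = ordered_pair v i" "i \<in> S - {v}" using e by (auto simp: ordered_pair_def)
    then show ?thesis by blast
  next
    case 3
    then show ?thesis using e by (auto simp: ordered_pairs_def)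
  qed
next
  fix e assume "e \<in> ordered_pair v ` (S - {v}) \<union> ordered_pairs (S - {v})"
  then show "e \<in> ordered_pairs S"
    using assms by (auto simp: ordered_pairs_def ordered_pair_def min_def max_def)
qed

lemma ordered_pairs_disjoint: "ordered_pair v ` T \<inter> ordered_pairs (S - {v}) = {}"
  by (auto simp: ordered_pairs_def ordered_pair_def min_def max_def split: if_splits)

lemma ordered_pair_in_ordered_pairs:
  "x \<in> S \<Longrightarrow> y \<in> S \<Longrightarrow> x \<noteq> y \<Longrightarrow> ordered_pair x y \<in> ordered_pairs S"
  by (auto simp: ordered_pairs_def ordered_pair_def min_def max_def)

definition joined :: "('a \<times> 'a \<Rightarrow> bool) \<Rightarrow> 'a \<Rightarrow> 'a::linorder \<Rightarrow> bool" where
  "joined f x y = (x \<noteq> y \<and> f (ordered_pair x y))"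

lemma finite_set_Pi_pmf_bool:
  fixes p :: "'a \<Rightarrow> bool pmf"
  assumes "finite A"
  shows "finite (set_pmf (Pi_pmf A dflt p))"
  using assms unfolding set_Pi_pmf[OF assms] by (intro finite_PiE_dflt) (auto intro: finite_subset[OF subset_UNIV])

lemma expectation_pair_pmf_finite:
  fixes f :: "'a \<times> 'b \<Rightarrow> real"
  assumes "finite (set_pmf p)" "finite (set_pmf q)"
  shows "measure_pmf.expectation (pair_pmf p q) f =
    measure_pmf.expectation p (\<lambda>a. measure_pmf.expectation q (\<lambda>b. f (a, b)))"
proof -
  have "measure_pmf.expectation (pair_pmf p q) f
      = (\<Sum>z\<in>set_pmf p \<times> set_pmf q. f z * pmf (pair_pmf p q) z)"
    using assms by (intro integral_measure_pmf_real) auto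
  also have "\<dots> = (\<Sum>a\<in>set_pmf p. (\<Sum>b\<in>set_pmf q. f (a, b) * pmf q b) * pmf p a)"
    by (simp add: sum.cartesian_product' pmf_pair sum_distrib_left sum_distrib_right mult_ac)
  also have "\<dots> = measure_pmf.expectation p (\<lambda>a. measure_pmf.expectation q (\<lambda>b. f (a, b)))"
    using assms by (simp add: integral_measure_pmf_real[where A = "set_pmf p"]
        integral_measure_pmf_real[where A = "set_pmf q"])
  finally show ?thesis .
qed

text \<open>
  The heart of the argument, by induction on the size of the graph. Exploring a vertex \<open>v \<in> N\<close>
  costs a factor \<open>exp (- h)\<close> and turns \<open>N\<close> into \<open>N - {v}\<close> together with the neighbours of \<open>v\<close>.
  By the induction hypothesis the rest contributes at least the product of \<open>y\<close> over this new set,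
  whose expectation over the coins at \<open>v\<close> factorises. A neighbour of \<open>v\<close> that already belongs to
  \<open>N\<close> is counted twice in the factorised form, which only lowers the bound since \<open>y \<le> 1\<close>;
  likewise restricting the product in \<open>sub\<close> from \<open>V\<close> to \<open>S\<close> only enlarges it.
\<close>
lemma prod_le_exploration_laplace:
  fixes q :: "'a::linorder \<times> 'a \<Rightarrow> real" and y :: "'a \<Rightarrow> real" and h :: real
  assumes V: "finite V"
    and q: "\<And>e. e \<in> ordered_pairs V \<Longrightarrow> 0 \<le> q e \<and> q e \<le> 1"
    and y: "\<And>v. v \<in> V \<Longrightarrow> 0 \<le> y v \<and> y v \<le> 1"
    and h: "0 \<le> h"
    and sub: "\<And>v. v \<in> V \<Longrightarrow>
      y v \<le> exp (- h) * (\<Prod>x\<in>V - {v}. 1 - q (ordered_pair v x) * (1 - y x))"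
    and "N \<subseteq> S" "S \<subseteq> V"
  shows "(\<Prod>u\<in>N. y u) \<le> measure_pmf.expectation
      (Pi_pmf (ordered_pairs S) False (\<lambda>e. bernoulli_pmf (q e)))
      (\<lambda>f. exp (- h * card (cluster (joined f) S N)))"
  using \<open>N \<subseteq> S\<close> \<open>S \<subseteq> V\<close>
proof (induction "card S" arbitrary: S N)
  case 0
  then have "S = {}" using finite_subset[OF _ V] by auto
  then show ?case using 0 by (simp add: cluster_empty)
next
  case (Suc k)
  show ?case
  proof (cases "N = {}")
    case True
    then show ?thesis by (simp add: cluster_empty)
  next
    case False
    then obtain v where v: "v \<in> N" by blast
    have finS: "finite S" using Suc.prems V finite_subset by blast
    have vS: "v \<in> S" using v Suc.prems by blast
    have finN: "finite N" using Suc.prems finS finite_subset by blast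
    let ?T = "S - {v}"
    let ?A = "ordered_pair v ` ?T" and ?B = "ordered_pairs (S - {v})"
    let ?p = "\<lambda>e. bernoulli_pmf (q e)"
    let ?PA = "Pi_pmf ?A False ?p" and ?PB = "Pi_pmf ?B False ?p"
    let ?nb = "\<lambda>g. {x \<in> ?T. g (ordered_pair v x)}"
    have finA: "finite ?A" and finB: "finite ?B"
      using finS by (auto intro: finite_ordered_pairs)
    have finPA: "finite (set_pmf ?PA)" and finPB: "finite (set_pmf ?PB)"
      using finite_set_Pi_pmf_bool finA finB by blast+
    have cardT: "k = card ?T" using Suc.hyps(2) vS finS by simp
    have yT: "0 \<le> y x \<and> y x \<le> 1" if "x \<in> S" for x
      using y that Suc.prems by blast
    let ?F = "\<lambda>f. exp (- h * card (cluster (joined f) S N))"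
    let ?mix = "\<lambda>g f x. if x \<in> ?A then g x else f x"
    have split: "measure_pmf.expectation (Pi_pmf (ordered_pairs S) False ?p) ?F
        = measure_pmf.expectation ?PA
            (\<lambda>g. measure_pmf.expectation ?PB (\<lambda>f. ?F (?mix g f)))"
      using ordered_pairs_split[OF vS] ordered_pairs_disjoint[of v ?T S] finA finB
      by (simp add: Pi_pmf_union expectation_pair_pmf_finite[OF finPA finPB] case_prod_unfold)
    have inner: "exp (- h) * (\<Prod>u\<in>N - {v}. y u) * (\<Prod>x\<in>?T. if g (ordered_pair v x) then y x else 1)
        \<le> measure_pmf.expectation ?PB (\<lambda>f. ?F (?mix g f))" for g
    proof -
      let ?N = "N - {v} \<union> ?nb g"
      have sub': "?N \<subseteq> ?T" using Suc.prems by auto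
      have "(\<Prod>u\<in>N - {v}. y u) * (\<Prod>x\<in>?T. if g (ordered_pair v x) then y x else 1)
          = (\<Prod>u\<in>N - {v}. y u) * (\<Prod>x\<in>?nb g. y x)"
        by (simp only: prod.inter_filter[OF finite_Diff[OF finS]])
      also have "\<dots> = (\<Prod>u\<in>?N. y u) * (\<Prod>u\<in>(N - {v}) \<inter> ?nb g. y u)"
        using finS finN by (subst prod.union_inter) auto
      also have "\<dots> \<le> (\<Prod>u\<in>?N. y u) * 1"
        using sub' yT by (intro mult_left_mono prod_le_1 prod_nonneg) auto
      finally have "exp (- h) * (\<Prod>u\<in>N - {v}. y u) * (\<Prod>x\<in>?T. if g (ordered_pair v x) then y x else 1)
          \<le> exp (- h) * (\<Prod>u\<in>?N. y u)"
        by (simp add: mult.assoc)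
      also have "\<dots> \<le> exp (- h) * measure_pmf.expectation ?PB
            (\<lambda>f. exp (- h * card (cluster (joined f) ?T ?N)))"
        using Suc.hyps(1)[OF cardT sub'] Suc.prems by (intro mult_left_mono) auto
      also have "\<dots> = measure_pmf.expectation ?PB
            (\<lambda>f. exp (- h) * exp (- h * card (cluster (joined f) ?T ?N)))"
        by simp
      also have "\<dots> \<le> measure_pmf.expectation ?PB (\<lambda>f. ?F (?mix g f))"
      proof (intro integral_mono integrable_measure_pmf_finite finPB)
        fix f
        have nb: "{x \<in> ?T. joined (?mix g f) v x} = ?nb g"
          by (auto simp: joined_def)
        have old: "cluster (joined (?mix g f)) ?T ?N = cluster (joined f) ?T ?N"
        proof (rule cluster_cong[OF sub'])
          fix x x' assume "x \<in> ?T" "x' \<in> ?T"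
          then have "x \<noteq> x' \<Longrightarrow> ordered_pair x x' \<notin> ?A"
            using ordered_pairs_disjoint[of v ?T S] ordered_pair_in_ordered_pairs[of x ?T x']
            by blast
          then show "joined (?mix g f) x x' = joined f x x'"
            unfolding joined_def by (cases "x = x'") auto
        qed
        have "card (cluster (joined (?mix g f)) S N)
            \<le> Suc (card (cluster (joined f) ?T ?N))"
          using card_cluster_peel[OF finS Suc.prems(1) v, of "joined (?mix g f)"]
          unfolding nb old .
        then have "h * card (cluster (joined (?mix g f)) S N)
            \<le> h * Suc (card (cluster (joined f) ?T ?N))"
          using h by (intro mult_left_mono) auto
        then show "exp (- h) * exp (- h * card (cluster (joined f) ?T ?N)) \<le> ?F (?mix g f)"
          by (simp add: exp_add[symmetric] algebra_simps)
      qed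
      finally show ?thesis .
    qed
    have "(\<Prod>u\<in>N. y u) = y v * (\<Prod>u\<in>N - {v}. y u)"
      using v finN by (simp add: prod.remove)
    also have "\<dots> \<le> (exp (- h) * (\<Prod>x\<in>?T. 1 - q (ordered_pair v x) * (1 - y x)))
        * (\<Prod>u\<in>N - {v}. y u)"
    proof (rule mult_right_mono)
      have f01: "0 \<le> 1 - q (ordered_pair v x) * (1 - y x)
          \<and> 1 - q (ordered_pair v x) * (1 - y x) \<le> 1" if "x \<in> V - {v}" for x
      proof -
        have "ordered_pair v x \<in> ordered_pairs V"
          using that vS Suc.prems by (intro ordered_pair_in_ordered_pairs) auto
        then have "0 \<le> q (ordered_pair v x)" "q (ordered_pair v x) \<le> 1" "0 \<le> y x" "y x \<le> 1"
          using q y that by auto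
        then show ?thesis
          using mult_mono[of "q (ordered_pair v x)" 1 "1 - y x" 1] by auto
      qed
      have "(\<Prod>x\<in>V - {v}. 1 - q (ordered_pair v x) * (1 - y x))
          \<le> (\<Prod>x\<in>?T. 1 - q (ordered_pair v x) * (1 - y x))"
      proof -
        have "(\<Prod>x\<in>V - {v}. 1 - q (ordered_pair v x) * (1 - y x))
            = (\<Prod>x\<in>(V - {v}) - ?T. 1 - q (ordered_pair v x) * (1 - y x))
              * (\<Prod>x\<in>?T. 1 - q (ordered_pair v x) * (1 - y x))"
          using V Suc.prems by (intro prod.subset_diff) auto
        also have "\<dots> \<le> 1 * (\<Prod>x\<in>?T. 1 - q (ordered_pair v x) * (1 - y x))"
          using f01 Suc.prems by (intro mult_right_mono prod_le_1 prod_nonneg) auto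
        finally show ?thesis by simp
      qed
      then show "y v \<le> exp (- h) * (\<Prod>x\<in>?T. 1 - q (ordered_pair v x) * (1 - y x))"
        using sub[of v] vS Suc.prems
        by (meson exp_ge_zero mult_left_mono order_trans subsetD)
      show "0 \<le> (\<Prod>u\<in>N - {v}. y u)"
        using yT Suc.prems by (intro prod_nonneg) auto
    qed
    also have "(\<Prod>x\<in>?T. 1 - q (ordered_pair v x) * (1 - y x))
        = measure_pmf.expectation ?PA (\<lambda>g. \<Prod>x\<in>?T. if g (ordered_pair v x) then y x else 1)"
    proof -
      \<comment> \<open>Reindexed by coins instead of vertices, so that the product formula for independent
        coordinates applies.\<close>
      let ?x = "inv_into ?T (ordered_pair v)"
      have inj: "inj_on (ordered_pair v) ?T"
        using inj_ordered_pair inj_on_subset by blast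
      have "measure_pmf.expectation ?PA (\<lambda>g. \<Prod>x\<in>?T. if g (ordered_pair v x) then y x else 1)
          = measure_pmf.expectation ?PA (\<lambda>g. \<Prod>e\<in>?A. if g e then y (?x e) else 1)"
        unfolding prod.reindex[OF inj] o_def
        by (intro Bochner_Integration.integral_cong prod.cong refl) (simp add: inv_into_f_f[OF inj])
      also have "\<dots> = (\<Prod>e\<in>?A. measure_pmf.expectation (?p e) (\<lambda>b. if b then y (?x e) else 1))"
        using yT by (intro expectation_prod_Pi_pmf finA integrable_measure_pmf_finite)
          (auto intro: finite_subset[OF subset_UNIV] simp: inv_into_f_f[OF inj])
      also have "\<dots> = (\<Prod>x\<in>?T. 1 - q (ordered_pair v x) * (1 - y x))"
        unfolding prod.reindex[OF inj] o_def
      proof (intro prod.cong refl)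
        fix x assume x: "x \<in> ?T"
        then have "ordered_pair v x \<in> ordered_pairs V"
          using vS Suc.prems by (intro ordered_pair_in_ordered_pairs) auto
        then have "0 \<le> q (ordered_pair v x)" "q (ordered_pair v x) \<le> 1"
          using q by auto
        then show "measure_pmf.expectation (?p (ordered_pair v x))
              (\<lambda>b. if b then y (?x (ordered_pair v x)) else 1)
            = 1 - q (ordered_pair v x) * (1 - y x)"
          using x by (simp add: inv_into_f_f[OF inj] algebra_simps)
      qed
      finally show ?thesis by simp
    qed
    also have "(exp (- h) * measure_pmf.expectation ?PA (\<lambda>g. \<Prod>x\<in>?T. if g (ordered_pair v x) then y x else 1))
        * (\<Prod>u\<in>N - {v}. y u)
      = measure_pmf.expectation ?PA (\<lambda>g. exp (- h) * (\<Prod>u\<in>N - {v}. y u)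
          * (\<Prod>x\<in>?T. if g (ordered_pair v x) then y x else 1))"
      by simp
    also have "\<dots> \<le> measure_pmf.expectation ?PA
            (\<lambda>g. measure_pmf.expectation ?PB (\<lambda>f. ?F (?mix g f)))"
      by (intro integral_mono integrable_measure_pmf_finite finPA inner)
    finally show ?thesis
      unfolding split .
  qed
qed

section \<open>Moments of the quantile weights\<close>

text \<open>
  The \<open>j\<close>-th quantile weight exceeds \<open>x\<close> roughly when \<open>j < t\<close> for \<open>t = n P(W > x)\<close>, so this bound
  and the next one measure how far the empirical tail of the weights is from that of \<open>W\<close>.
\<close>
lemma card_below_le:
  assumes "0 \<le> t"
  shows "real (card {j \<in> {1..n}. real j < t}) \<le> t"
proof -
  have "{j \<in> {1..n}. real j < t} \<subseteq> {1..nat \<lfloor>t\<rfloor>}"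
    by (auto simp: le_nat_floor)
  then have "card {j \<in> {1..n}. real j < t} \<le> card {1..nat \<lfloor>t\<rfloor>}"
    by (intro card_mono) auto
  then have "real (card {j \<in> {1..n}. real j < t}) \<le> real (nat \<lfloor>t\<rfloor>)"
    by simp
  also have "\<dots> \<le> t"
    using assms by simp
  finally show ?thesis .
qed

lemma le_card_below:
  assumes "t \<le> real n"
  shows "t \<le> real (card {j \<in> {1..n}. real j < t}) + 1"
proof -
  have "{1..nat \<lceil>t\<rceil> - 1} \<subseteq> {j \<in> {1..n}. real j < t}"
  proof
    fix j assume "j \<in> {1..nat \<lceil>t\<rceil> - 1}"
    then have j: "1 \<le> j" "int j < \<lceil>t\<rceil>" by auto
    then have "real j < t" by (simp add: less_ceiling_iff)
    then show "j \<in> {j \<in> {1..n}. real j < t}" using j assms by auto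
  qed
  then have "card {1..nat \<lceil>t\<rceil> - 1} \<le> card {j \<in> {1..n}. real j < t}"
    by (intro card_mono) auto
  then have "nat \<lceil>t\<rceil> - 1 \<le> card {j \<in> {1..n}. real j < t}"
    unfolding card_atLeastAtMost by linarith
  then have "real (nat \<lceil>t\<rceil>) \<le> real (card {j \<in> {1..n}. real j < t}) + 1" by linarith
  moreover have "t \<le> real (nat \<lceil>t\<rceil>)" by (rule real_nat_ceiling_ge)
  ultimately show ?thesis by linarith
qed

lemma tail_inverse_le:
  assumes "0 < s" "1 - F s \<le> u"
  shows "tail_inverse F u \<le> s"
  using assms unfolding tail_inverse_def
  by (auto intro!: cInf_lower bdd_belowI[where m = 0])

context real_distribution
begin

text \<open>
  The case \<open>x = 0\<close> is nonnegativity. The convergence of the distribution function to \<open>1\<close>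
  guarantees that the infimum is taken over a nonempty set.
\<close>
lemma le_tail_inverse_cdf:
  assumes u: "0 < u" "u < 1" and x: "0 \<le> x" "x = 0 \<or> u < 1 - cdf M x"
  shows "x \<le> tail_inverse (cdf M) u"
proof -
  have "(cdf M \<longlongrightarrow> 1) at_top"
    using cdf_lim_at_top unfolding prob_space .
  then have "\<forall>\<^sub>F s in at_top. 1 - u < cdf M s \<and> 0 < s"
    using u by (intro eventually_conj order_tendstoD(1) eventually_gt_at_top) auto
  then obtain s where s: "1 - u < cdf M s" "0 < s"
    using eventually_happens'[OF trivial_limit_at_top_linorder] by blast
  have "x \<le> Inf {s. 0 < s \<and> 1 - cdf M s \<le> u}"
  proof (rule cInf_greatest)
    show "{s. 0 < s \<and> 1 - cdf M s \<le> u} \<noteq> {}" using s by force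
    fix t assume t: "t \<in> {s. 0 < s \<and> 1 - cdf M s \<le> u}"
    show "x \<le> t"
    proof (rule ccontr)
      assume "\<not> x \<le> t"
      then show False using t x cdf_nondecreasing[of t x] by auto
    qed
  qed
  then show ?thesis using u by (simp add: tail_inverse_def)
qed

lemma quantile_weight_nonneg:
  assumes "j \<in> {1..n}"
  shows "0 \<le> quantile_weight (cdf M) n j"
proof (cases "j = n")
  case True
  then show ?thesis using assms by (simp add: quantile_weight_def tail_inverse_def)
next
  case False
  then show ?thesis
    using assms le_tail_inverse_cdf[of "real j / real n" 0] by (simp add: quantile_weight_def)
qed

text \<open>
  Here the inequality for the weight is strict, in the converse below it is weak. For each \<open>j\<close>
  they differ in a single level \<open>x\<close> only, which the integrals over \<open>x\<close> ignore.
\<close>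
lemma quantile_weight_gtD:
  assumes "0 < n" "0 < x" "x < quantile_weight (cdf M) n j"
  shows "real j < n * (1 - cdf M x)"
proof (rule ccontr)
  assume "\<not> real j < n * (1 - cdf M x)"
  then have "1 - cdf M x \<le> real j / real n"
    using assms(1) by (simp add: field_simps)
  then show False
    using tail_inverse_le[OF assms(2)] assms(3) by (force simp: quantile_weight_def)
qed

lemma le_quantile_weightI:
  assumes "j \<in> {1..n}" "0 < x" "real j < n * (1 - cdf M x)"
  shows "x \<le> quantile_weight (cdf M) n j"
proof -
  have *: "real j / real n < 1 - cdf M x"
    using assms by (simp add: field_simps)
  then have "real j / real n < 1"
    using cdf_nonneg[of x] by linarith
  then show ?thesis
    using assms * le_tail_inverse_cdf[of "real j / real n" x] by (simp add: quantile_weight_def)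
qed

lemma borel_measurable_cdf [measurable]: "cdf M \<in> borel_measurable borel"
  by (intro borel_measurable_mono monoI cdf_nondecreasing)

lemma emeasure_greaterThan: "emeasure M {x<..} = ennreal (1 - cdf M x)"
proof -
  have "{x<..} = space M - {..x}" by auto
  then show ?thesis
    by (simp add: emeasure_eq_measure prob_compl cdf_def del: space_eq_univ)
qed

text \<open>
  The inner integral on the left is \<open>G \<omega>\<close> for the primitive \<open>G\<close> of \<open>g\<close> vanishing at \<open>0\<close>. Taking
  \<open>g x = 1\<close>, \<open>g x = 2 x\<close> and the indicator of \<open>{0<..L}\<close> yields the first two moments and the
  truncated mean.
\<close>
lemma layer_cake:
  assumes [measurable]: "g \<in> borel_measurable borel"
  shows "(\<integral>\<^sup>+\<omega>. (\<integral>\<^sup>+x. g x * indicator {0<..<\<omega>} x \<partial>lborel) \<partial>M)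
    = (\<integral>\<^sup>+x. g x * indicator {0<..} x * ennreal (1 - cdf M x) \<partial>lborel)"
proof -
  interpret pair_sigma_finite M lborel
    unfolding pair_sigma_finite_def
    by (simp add: sigma_finite_lborel finite_measure.axioms(1) finite_measure_axioms)
  let ?f = "\<lambda>\<omega> x. if 0 < x \<and> x < \<omega> then g x else 0"
  have "(\<integral>\<^sup>+\<omega>. (\<integral>\<^sup>+x. g x * indicator {0<..<\<omega>} x \<partial>lborel) \<partial>M)
      = (\<integral>\<^sup>+\<omega>. (\<integral>\<^sup>+x. ?f \<omega> x \<partial>lborel) \<partial>M)"
    by (intro nn_integral_cong) (auto split: split_indicator)
  also have "\<dots> = (\<integral>\<^sup>+x. (\<integral>\<^sup>+\<omega>. ?f \<omega> x \<partial>M) \<partial>lborel)"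
    by (rule Fubini'[symmetric]) measurable
  also have "\<dots> = (\<integral>\<^sup>+x. (\<integral>\<^sup>+\<omega>. g x * indicator {0<..} x * indicator {x<..} \<omega> \<partial>M) \<partial>lborel)"
    by (intro nn_integral_cong) (auto split: split_indicator)
  also have "\<dots> = (\<integral>\<^sup>+x. g x * indicator {0<..} x * ennreal (1 - cdf M x) \<partial>lborel)"
    by (intro nn_integral_cong) (simp add: nn_integral_cmult emeasure_greaterThan)
  finally show ?thesis .
qed

text \<open>
  For increasing \<open>G\<close> with \<open>G 0 = 0\<close>, the sum of \<open>G\<close> over the quantile weights is a lower Riemann
  sum for \<open>n E G(W)\<close>; comparing layer by layer reduces this to counting weights above a level.
\<close>
lemma sum_quantile_layers_le:
  assumes [measurable]: "g \<in> borel_measurable borel" and n: "0 < n"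
  shows "(\<Sum>j=1..n. \<integral>\<^sup>+x. g x * indicator {0<..<quantile_weight (cdf M) n j} x \<partial>lborel)
    \<le> of_nat n * (\<integral>\<^sup>+\<omega>. (\<integral>\<^sup>+x. g x * indicator {0<..<\<omega>} x \<partial>lborel) \<partial>M)"
proof -
  let ?w = "quantile_weight (cdf M) n"
  have "(\<Sum>j=1..n. \<integral>\<^sup>+x. g x * indicator {0<..<?w j} x \<partial>lborel)
      = (\<integral>\<^sup>+x. (\<Sum>j=1..n. g x * indicator {0<..<?w j} x) \<partial>lborel)"
    by (rule nn_integral_sum[symmetric]) measurable
  also have "\<dots> \<le> (\<integral>\<^sup>+x. of_nat n * (g x * indicator {0<..} x * ennreal (1 - cdf M x)) \<partial>lborel)"
  proof (rule nn_integral_mono)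
    fix x :: real
    show "(\<Sum>j=1..n. g x * indicator {0<..<?w j} x)
        \<le> of_nat n * (g x * indicator {0<..} x * ennreal (1 - cdf M x))"
    proof (cases "0 < x")
      case True
      let ?t = "n * (1 - cdf M x)"
      have c: "0 \<le> 1 - cdf M x" using cdf_bounded_prob[of x] by simp
      have "(\<Sum>j=1..n. if real j < ?t then 1 else 0 :: ennreal)
          = ennreal (real (card {j \<in> {1..n}. real j < ?t}))"
        by (simp add: sum.inter_filter[symmetric] ennreal_of_nat_eq_real_of_nat)
      also have "\<dots> \<le> ennreal ?t"
        using c by (intro ennreal_leI card_below_le) simp
      also have "ennreal ?t = of_nat n * ennreal (1 - cdf M x)"
        using c by (simp add: ennreal_mult ennreal_of_nat_eq_real_of_nat)
      finally have count: "(\<Sum>j=1..n. if real j < ?t then 1 else 0 :: ennreal)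
          \<le> of_nat n * ennreal (1 - cdf M x)" .
      have "(\<Sum>j=1..n. g x * indicator {0<..<?w j} x)
          \<le> (\<Sum>j=1..n. g x * (if real j < ?t then 1 else 0))"
        using quantile_weight_gtD[OF n True]
        by (intro sum_mono mult_left_mono) (auto split: split_indicator)
      also have "\<dots> = g x * (\<Sum>j=1..n. if real j < ?t then 1 else 0)"
        by (simp only: sum_distrib_left)
      also have "\<dots> \<le> g x * (of_nat n * ennreal (1 - cdf M x))"
        using count by (rule mult_left_mono) simp
      also have "\<dots> = of_nat n * (g x * indicator {0<..} x * ennreal (1 - cdf M x))"
        using True by (simp add: mult_ac)
      finally show ?thesis .
    qed (auto simp: indicator_def)
  qed
  also have "\<dots> = of_nat n * (\<integral>\<^sup>+x. g x * indicator {0<..} x * ennreal (1 - cdf M x) \<partial>lborel)"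
    by (rule nn_integral_cmult) measurable
  finally show ?thesis
    by (simp add: layer_cake)
qed

end

lemma nn_integral_layers_square:
  assumes "0 \<le> w"
  shows "(\<integral>\<^sup>+x. ennreal (2 * x) * indicator {0<..<w} x \<partial>lborel) = ennreal (w\<^sup>2)"
proof -
  have "(\<integral>\<^sup>+x. ennreal (2 * x) * indicator {0<..<w} x \<partial>lborel)
      = (\<integral>\<^sup>+x. ennreal (2 * x) * indicator {0..w} x \<partial>lborel)"
    using AE_lborel_singleton[of w]
    by (intro nn_integral_cong_AE) (auto split: split_indicator elim!: eventually_mono)
  also have "\<dots> = ennreal (w\<^sup>2 - 0\<^sup>2)"
    using assms by (intro nn_integral_FTC_Icc) (auto intro!: derivative_eq_intros)
  finally show ?thesis by simp
qed

context real_distribution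
begin

context
  assumes pos: "AE x in M. 0 < x"
begin

lemma sum_quantile_weight_le:
  assumes "0 < n" "integrable M (\<lambda>x. x)"
  shows "(\<Sum>j=1..n. quantile_weight (cdf M) n j) \<le> n * (\<integral>x. x \<partial>M)"
proof -
  let ?w = "quantile_weight (cdf M) n"
  have m: "0 \<le> (\<integral>x. x \<partial>M)"
    using pos by (intro integral_nonneg_AE) (auto elim!: eventually_mono)
  have "ennreal (\<Sum>j=1..n. ?w j) = (\<Sum>j=1..n. \<integral>\<^sup>+x. 1 * indicator {0<..<?w j} x \<partial>lborel)"
    using quantile_weight_nonneg[of _ n]
    by (subst sum_ennreal[symmetric]) (auto intro!: sum.cong simp del: sum_ennreal)
  also have "\<dots> \<le> of_nat n * (\<integral>\<^sup>+\<omega>. (\<integral>\<^sup>+x. 1 * indicator {0<..<\<omega>} x \<partial>lborel) \<partial>M)"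
    using assms by (intro sum_quantile_layers_le) auto
  also have "(\<integral>\<^sup>+\<omega>. (\<integral>\<^sup>+x. 1 * indicator {0<..<\<omega>} x \<partial>lborel) \<partial>M) = (\<integral>\<^sup>+\<omega>. ennreal \<omega> \<partial>M)"
    using pos by (intro nn_integral_cong_AE) (auto elim!: eventually_mono)
  also have "\<dots> = ennreal (\<integral>x. x \<partial>M)"
    using assms pos by (intro nn_integral_eq_integral) (auto elim!: eventually_mono)
  also have "of_nat n * \<dots> = ennreal (n * (\<integral>x. x \<partial>M))"
    using m by (simp add: ennreal_mult ennreal_of_nat_eq_real_of_nat)
  finally show ?thesis using m by (simp add: ennreal_le_iff)
qed

lemma sum_quantile_weight_square_le:
  assumes "0 < n" "integrable M (\<lambda>x. x\<^sup>2)"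
  shows "(\<Sum>j=1..n. (quantile_weight (cdf M) n j)\<^sup>2) \<le> n * (\<integral>x. x\<^sup>2 \<partial>M)"
proof -
  let ?w = "quantile_weight (cdf M) n"
  have "ennreal (\<Sum>j=1..n. (?w j)\<^sup>2)
      = (\<Sum>j=1..n. \<integral>\<^sup>+x. ennreal (2 * x) * indicator {0<..<?w j} x \<partial>lborel)"
    unfolding sum_ennreal[symmetric, OF zero_le_power2]
    by (intro sum.cong refl nn_integral_layers_square[symmetric] quantile_weight_nonneg)
  also have "\<dots> \<le> of_nat n * (\<integral>\<^sup>+\<omega>. (\<integral>\<^sup>+x. ennreal (2 * x) * indicator {0<..<\<omega>} x \<partial>lborel) \<partial>M)"
    using assms by (intro sum_quantile_layers_le) auto
  also have "(\<integral>\<^sup>+\<omega>. (\<integral>\<^sup>+x. ennreal (2 * x) * indicator {0<..<\<omega>} x \<partial>lborel) \<partial>M)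
      = (\<integral>\<^sup>+\<omega>. ennreal (\<omega>\<^sup>2) \<partial>M)"
    using pos by (intro nn_integral_cong_AE)
      (auto elim!: eventually_mono simp: nn_integral_layers_square)
  also have "\<dots> = ennreal (\<integral>x. x\<^sup>2 \<partial>M)"
    using assms by (intro nn_integral_eq_integral) auto
  also have "of_nat n * \<dots> = ennreal (n * (\<integral>x. x\<^sup>2 \<partial>M))"
    by (simp add: ennreal_mult ennreal_of_nat_eq_real_of_nat)
  finally show ?thesis by (simp add: ennreal_le_iff)
qed

text \<open>
  In each layer \<open>0 < x \<le> L\<close> the count of weights falls short of \<open>n P(W > x)\<close> by at most one, so
  the total deficit is at most \<open>L\<close>.
\<close>
lemma truncated_mean_le_sum_quantile_weight:
  assumes n: "0 < n" and int: "integrable M (\<lambda>x. x)" and L: "0 < L"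
  shows "n * (\<integral>x. min L x \<partial>M) \<le> (\<Sum>j=1..n. quantile_weight (cdf M) n j) + L"
proof -
  let ?w = "quantile_weight (cdf M) n"
  have int': "integrable M (\<lambda>x. min L x)"
    using int by simp
  have m: "0 \<le> (\<integral>x. min L x \<partial>M)"
    using pos L by (intro integral_nonneg_AE) (auto elim!: eventually_mono)
  have "ennreal (\<integral>x. min L x \<partial>M) = (\<integral>\<^sup>+\<omega>. ennreal (min L \<omega>) \<partial>M)"
    using pos L by (intro nn_integral_eq_integral[symmetric] int') (auto elim!: eventually_mono)
  also have "\<dots> \<le> (\<integral>\<^sup>+\<omega>. (\<integral>\<^sup>+x. indicator {0<..L} x * indicator {0<..<\<omega>} x \<partial>lborel) \<partial>M)"
  proof (rule nn_integral_mono_AE, use pos in eventually_elim)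
    fix \<omega> :: real assume "0 < \<omega>"
    then have "ennreal (min L \<omega>) = emeasure lborel {0<..<min L \<omega>}"
      using L by simp
    also have "\<dots> \<le> emeasure lborel ({0<..L} \<inter> {0<..<\<omega>})"
      by (intro emeasure_mono) auto
    also have "\<dots> = (\<integral>\<^sup>+x. indicator {0<..L} x * indicator {0<..<\<omega>} x \<partial>lborel)"
      by (simp add: indicator_inter_arith[symmetric])
    finally show "ennreal (min L \<omega>) \<le> (\<integral>\<^sup>+x. indicator {0<..L} x * indicator {0<..<\<omega>} x \<partial>lborel)" .
  qed
  also have "\<dots> = (\<integral>\<^sup>+x. indicator {0<..L} x * indicator {0<..} x * ennreal (1 - cdf M x) \<partial>lborel)"
    by (rule layer_cake) measurable
  finally have "of_nat n * ennreal (\<integral>x. min L x \<partial>M)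
      \<le> of_nat n * (\<integral>\<^sup>+x. indicator {0<..L} x * indicator {0<..} x * ennreal (1 - cdf M x) \<partial>lborel)"
    by (rule mult_left_mono) simp
  also have "\<dots> = (\<integral>\<^sup>+x. of_nat n * (indicator {0<..L} x * indicator {0<..} x * ennreal (1 - cdf M x)) \<partial>lborel)"
    by (rule nn_integral_cmult[symmetric]) measurable
  also have "\<dots> \<le> (\<integral>\<^sup>+x. (\<Sum>j=1..n. indicator {0<..?w j} x) + indicator {0<..L} x \<partial>lborel)"
  proof (rule nn_integral_mono)
    fix x :: real
    let ?t = "n * (1 - cdf M x)"
    show "of_nat n * (indicator {0<..L} x * indicator {0<..} x * ennreal (1 - cdf M x))
        \<le> (\<Sum>j=1..n. indicator {0<..?w j} x) + indicator {0<..L} x"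
    proof (cases "x \<in> {0<..L}")
      case True
      have c: "0 \<le> 1 - cdf M x" using cdf_bounded_prob[of x] by simp
      have "of_nat n * ennreal (1 - cdf M x) = ennreal ?t"
        using c by (simp add: ennreal_mult ennreal_of_nat_eq_real_of_nat)
      also have "\<dots> \<le> ennreal (real (card {j \<in> {1..n}. real j < ?t}) + 1)"
        using cdf_nonneg[of x] by (intro ennreal_leI le_card_below) (simp add: mult_left_le)
      also have "\<dots> = (\<Sum>j=1..n. if real j < ?t then 1 else 0) + 1"
        by (simp add: sum.inter_filter[symmetric] ennreal_of_nat_eq_real_of_nat)
      also have "\<dots> \<le> (\<Sum>j=1..n. indicator {0<..?w j} x) + 1"
        using le_quantile_weightI[of _ n x] True
        by (intro add_right_mono sum_mono) (auto split: split_indicator)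
      finally show ?thesis using True by simp
    next
      case False
      then have "indicator {0<..L} x = (0 :: ennreal)" by (simp add: indicator_def)
      then show ?thesis by simp
    qed
  qed
  also have "\<dots> = (\<Sum>j=1..n. emeasure lborel {0<..?w j}) + emeasure lborel {0<..L}"
    by (simp add: nn_integral_add nn_integral_sum)
  also have "\<dots> = ennreal ((\<Sum>j=1..n. ?w j) + L)"
  proof -
    have "(\<Sum>j=1..n. emeasure lborel {0<..?w j}) = (\<Sum>j=1..n. ennreal (?w j))"
      using quantile_weight_nonneg[of _ n] by (intro sum.cong) auto
    also have "\<dots> = ennreal (\<Sum>j=1..n. ?w j)"
      by (intro sum_ennreal quantile_weight_nonneg)
    finally have "(\<Sum>j=1..n. emeasure lborel {0<..?w j}) = ennreal (\<Sum>j=1..n. ?w j)" .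
    moreover have "0 \<le> (\<Sum>j=1..n. ?w j)"
      by (intro sum_nonneg quantile_weight_nonneg)
    ultimately show ?thesis
      using L by (simp only: ennreal_plus emeasure_lborel_Ioc less_imp_le diff_zero)
  qed
  finally have "ennreal (n * (\<integral>x. min L x \<partial>M)) \<le> ennreal ((\<Sum>j=1..n. ?w j) + L)"
    using m by (simp add: ennreal_mult ennreal_of_nat_eq_real_of_nat)
  moreover have "0 \<le> (\<Sum>j=1..n. ?w j) + L"
    using L by (intro add_nonneg_nonneg sum_nonneg quantile_weight_nonneg) auto
  ultimately show ?thesis
    by (simp only: ennreal_le_iff)
qed

text \<open>
  Truncating at \<open>L\<close> loses at most \<open>E W\<^sup>2 / L\<close> of the mean, because \<open>x - min L x \<le> x\<^sup>2 / L\<close>. The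
  level \<open>L = sqrt n\<close> balances \<open>n / L\<close> against the deficit \<open>L\<close>.
\<close>
lemma mean_le_sum_quantile_weight:
  assumes n: "0 < n" and int: "integrable M (\<lambda>x. x)" "integrable M (\<lambda>x. x\<^sup>2)"
  shows "n * (\<integral>x. x \<partial>M)
    \<le> (\<Sum>j=1..n. quantile_weight (cdf M) n j) + sqrt n * (1 + (\<integral>x. x\<^sup>2 \<partial>M))"
proof -
  let ?L = "sqrt n"
  have L: "0 < ?L" using n by simp
  have "(\<integral>x. x \<partial>M) - (\<integral>x. x\<^sup>2 \<partial>M) / ?L = (\<integral>x. x - x\<^sup>2 / ?L \<partial>M)"
    using int by simp
  also have "\<dots> \<le> (\<integral>x. min ?L x \<partial>M)"
  proof (intro integral_mono)
    fix x :: real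
    have "0 \<le> (x - ?L)\<^sup>2 + x * ?L" if "?L \<le> x"
    proof -
      have "0 \<le> x" using that L by linarith
      then show ?thesis by simp
    qed
    then show "x - x\<^sup>2 / ?L \<le> min ?L x"
      using L by (auto simp: min_def field_simps power2_eq_square)
  qed (use int in auto)
  finally have "n * ((\<integral>x. x \<partial>M) - (\<integral>x. x\<^sup>2 \<partial>M) / ?L) \<le> n * (\<integral>x. min ?L x \<partial>M)"
    by (intro mult_left_mono) auto
  also have "\<dots> \<le> (\<Sum>j=1..n. quantile_weight (cdf M) n j) + ?L"
    by (rule truncated_mean_le_sum_quantile_weight[OF n int(1) L])
  finally have "n * (\<integral>x. x \<partial>M) - n * ((\<integral>x. x\<^sup>2 \<partial>M) / ?L)
      \<le> (\<Sum>j=1..n. quantile_weight (cdf M) n j) + ?L"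
    by (simp only: right_diff_distrib)
  moreover have "n * ((\<integral>x. x\<^sup>2 \<partial>M) / ?L) = ?L * (\<integral>x. x\<^sup>2 \<partial>M)"
  proof -
    have "n * ((\<integral>x. x\<^sup>2 \<partial>M) / ?L) = (n / ?L) * (\<integral>x. x\<^sup>2 \<partial>M)" by simp
    also have "n / ?L = ?L" by (rule real_div_sqrt) simp
    finally show ?thesis .
  qed
  ultimately show ?thesis
    by (simp add: algebra_simps)
qed

end

end

section \<open>Component sizes in the Norros--Reittu graph\<close>

lemma vertex_pairs_eq: "vertex_pairs n = ordered_pairs {1..n}"
  by (auto simp: vertex_pairs_def ordered_pairs_def)

lemma component_subset_cluster:
  assumes "x \<in> V"
  shows "component V {{i, j} | i j. (i, j) \<in> ordered_pairs V \<and> f (i, j)} x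
    \<subseteq> cluster (joined f) V {x}"
proof
  let ?E = "{{i, j} | i j. (i, j) \<in> ordered_pairs V \<and> f (i, j)}"
  fix y assume "y \<in> component V ?E x"
  then have "(x, y) \<in> {(a, b). {a, b} \<in> ?E}\<^sup>*"
    by (simp add: component_def)
  then show "y \<in> cluster (joined f) V {x}"
  proof induction
    case base
    show ?case by (rule cluster.seed) simp
  next
    case (step a b)
    then obtain i j where ij: "{a, b} = {i, j}" "(i, j) \<in> ordered_pairs V" "f (i, j)"
      by blast
    have "i \<in> V" "j \<in> V" "i < j"
      using ij(2) by (auto simp: ordered_pairs_def)
    then have "joined f i j" "joined f j i"
      using ij(3) by (simp_all add: joined_def ordered_pair_def)
    moreover have "a = i \<and> b = j \<or> a = j \<and> b = i"
      using ij(1) by (simp only: doubleton_eq_iff)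
    ultimately have "b \<in> V" "joined f a b"
      using \<open>i \<in> V\<close> \<open>j \<in> V\<close> by blast+
    then show ?case by (rule cluster.step[OF step.IH])
  qed
qed

text \<open>
  Convexity of the exponential on the segment from \<open>0\<close> to \<open>- a\<close>. It replaces the Bernoulli
  factors of the exploration by Poisson ones, and the latter multiply to a single exponential.
\<close>
lemma exp_le_one_minus_bernoulli:
  fixes a z :: real
  assumes "0 \<le> z" "z \<le> 1"
  shows "exp (- a * z) \<le> 1 - (1 - exp (- a)) * z"
proof -
  have "exp ((1 - z) *\<^sub>R 0 + z *\<^sub>R (- a)) \<le> (1 - z) * exp 0 + z * exp (- a)"
    using assms by (intro convex_onD[OF exp_convex]) auto
  then show ?thesis by (simp add: algebra_simps)
qed

text \<open>
  Because the edge probabilities have rank one, the inequalities that a subsolution has to satisfy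
  at each vertex reduce, for \<open>y u = exp (- h - \<rho> * w u)\<close>, to the single inequality \<open>sub\<close> for the
  number \<open>\<rho>\<close>.
\<close>
lemma exp_le_component_laplace:
  fixes w :: "nat \<Rightarrow> real" and h \<rho> :: real
  assumes w: "\<And>j. j \<in> {1..n} \<Longrightarrow> 0 \<le> w j"
    and l: "0 < (\<Sum>j=1..n. w j)"
    and h: "0 \<le> h" and \<rho>: "0 \<le> \<rho>"
    and sub: "(\<Sum>j=1..n. w j * (1 - exp (- h - \<rho> * w j))) \<le> \<rho> * (\<Sum>j=1..n. w j)"
    and v: "v \<in> {1..n}"
  shows "exp (- h - \<rho> * w v)
    \<le> measure_pmf.expectation (norros_reittu n w) (\<lambda>E. exp (- h * card (component {1..n} E v)))"
proof -
  let ?V = "{1..n}"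
  define l where "l = (\<Sum>j=1..n. w j)"
  have lpos: "0 < l" using assms(2) by (simp add: l_def)
  define q where "q = (\<lambda>(i, j). 1 - exp (- (w i * w j / l)))"
  define y where "y = (\<lambda>u. exp (- h - \<rho> * w u))"
  have y01: "0 \<le> y u \<and> y u \<le> 1" if "u \<in> ?V" for u
    using h mult_nonneg_nonneg[OF \<rho> w[OF that]] by (simp add: y_def)
  have q_pair: "q (ordered_pair u x) = 1 - exp (- (w u * w x / l))" for u x
    by (auto simp: q_def ordered_pair_def min_def max_def mult.commute)
  have sub_y: "y u \<le> exp (- h) * (\<Prod>x\<in>?V - {u}. 1 - q (ordered_pair u x) * (1 - y x))"
    if u: "u \<in> ?V" for u
  proof -
    have factor: "0 \<le> exp (- (w u * w x / l) * (1 - y x)) \<and>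
        exp (- (w u * w x / l) * (1 - y x)) \<le> 1 - q (ordered_pair u x) * (1 - y x)"
      if "x \<in> ?V - {u}" for x
    proof -
      have "0 \<le> 1 - y x" "1 - y x \<le> 1" using y01[of x] that by auto
      then have "exp (- (w u * w x / l) * (1 - y x)) \<le> 1 - q (ordered_pair u x) * (1 - y x)"
        unfolding q_pair by (rule exp_le_one_minus_bernoulli)
      then show ?thesis using exp_ge_zero by blast
    qed
    have "w u * (\<Sum>x\<in>?V - {u}. w x * (1 - y x)) \<le> w u * (\<Sum>x\<in>?V. w x * (1 - y x))"
      using u w y01 by (intro mult_left_mono sum_mono2) auto
    also have "\<dots> \<le> w u * (\<rho> * l)"
      using sub w[OF u] by (intro mult_left_mono) (auto simp: y_def l_def)
    finally have "w u * (\<Sum>x\<in>?V - {u}. w x * (1 - y x)) / l \<le> \<rho> * w u"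
      using lpos by (simp add: field_simps)
    then have "exp (- h - \<rho> * w u) \<le> exp (- h + - (w u * (\<Sum>x\<in>?V - {u}. w x * (1 - y x)) / l))"
      by (subst exp_le_cancel_iff) linarith
    then have "y u \<le> exp (- h) * exp (- (w u * (\<Sum>x\<in>?V - {u}. w x * (1 - y x)) / l))"
      by (simp only: y_def exp_add)
    also have "- (w u * (\<Sum>x\<in>?V - {u}. w x * (1 - y x)) / l)
        = (\<Sum>x\<in>?V - {u}. - (w u * w x / l) * (1 - y x))"
      by (simp add: sum_distrib_left sum_divide_distrib sum_negf mult.assoc)
    also have "exp \<dots> = (\<Prod>x\<in>?V - {u}. exp (- (w u * w x / l) * (1 - y x)))"
      by (rule exp_sum) simp
    also have "exp (- h) * \<dots> \<le> exp (- h) * (\<Prod>x\<in>?V - {u}. 1 - q (ordered_pair u x) * (1 - y x))"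
      by (intro mult_left_mono prod_mono factor) auto
    finally show ?thesis .
  qed
  have "y v = (\<Prod>u\<in>{v}. y u)" by simp
  also have "\<dots> \<le> measure_pmf.expectation
      (Pi_pmf (ordered_pairs ?V) False (\<lambda>e. bernoulli_pmf (q e)))
      (\<lambda>f. exp (- h * card (cluster (joined f) ?V {v})))"
  proof (rule prod_le_exploration_laplace[OF _ _ y01 h sub_y])
    fix e assume "e \<in> ordered_pairs ?V"
    then have "0 \<le> w (fst e) * w (snd e) / l"
      using w lpos by (auto simp: ordered_pairs_def)
    then show "0 \<le> q e \<and> q e \<le> 1"
      by (simp add: q_def case_prod_unfold)
  qed (use v in auto)
  also have "\<dots> \<le> measure_pmf.expectation
      (Pi_pmf (ordered_pairs ?V) False (\<lambda>e. bernoulli_pmf (q e)))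
      (\<lambda>f. exp (- h * card (component ?V {{i, j} | i j. (i, j) \<in> ordered_pairs ?V \<and> f (i, j)} v)))"
  proof (intro integral_mono integrable_measure_pmf_finite finite_set_Pi_pmf_bool finite_ordered_pairs)
    fix f
    have "finite (cluster (joined f) ?V {v})"
      by (rule finite_subset[OF cluster_subset]) (use v in auto)
    then have "card (component ?V {{i, j} | i j. (i, j) \<in> ordered_pairs ?V \<and> f (i, j)} v)
        \<le> card (cluster (joined f) ?V {v})"
      by (rule card_mono[OF _ component_subset_cluster[OF v]])
    then show "exp (- h * card (cluster (joined f) ?V {v}))
      \<le> exp (- h * card (component ?V {{i, j} | i j. (i, j) \<in> ordered_pairs ?V \<and> f (i, j)} v))"
      using h by (simp add: mult_left_mono)
  qed auto
  also have "\<dots> = measure_pmf.expectation (norros_reittu n w)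
      (\<lambda>E. exp (- h * card (component ?V E v)))"
    by (simp add: norros_reittu_def vertex_pairs_eq q_def l_def case_prod_unfold)
  finally show ?thesis by (simp add: y_def)
qed

text \<open>
  Markov's inequality for \<open>1 - exp (- |C(v)| / k)\<close>, which is at least \<open>1 - 1/e \<ge> 1/2\<close> on the event.
\<close>
lemma prob_component_gt_le:
  fixes w :: "nat \<Rightarrow> real" and k \<rho> :: real
  assumes w: "\<And>j. j \<in> {1..n} \<Longrightarrow> 0 \<le> w j"
    and l: "0 < (\<Sum>j=1..n. w j)"
    and k: "0 < k" and \<rho>: "0 \<le> \<rho>"
    and sub: "(\<Sum>j=1..n. w j * (1 - exp (- (1 / k) - \<rho> * w j))) \<le> \<rho> * (\<Sum>j=1..n. w j)"
    and v: "v \<in> {1..n}"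
  shows "measure_pmf.prob (norros_reittu n w) {E. k < card (component {1..n} E v)}
    \<le> 2 * (1 / k + \<rho> * w v)"
proof -
  let ?p = "norros_reittu n w"
  let ?C = "\<lambda>E. real (card (component {1..n} E v))"
  have fin: "finite (set_pmf ?p)"
    unfolding norros_reittu_def vertex_pairs_eq
    by (simp add: finite_set_Pi_pmf_bool finite_ordered_pairs)
  note int = integrable_measure_pmf_finite[OF fin]
  have e: "exp (-1 :: real) \<le> 1 / 2"
    using exp_ge_add_one_self[of 1] by (simp add: exp_minus field_simps)
  have "measure_pmf.prob ?p {E. k < ?C E} / 2
      = measure_pmf.expectation ?p (\<lambda>E. indicator {E. k < ?C E} E / 2)"
    by simp
  also have "\<dots> \<le> measure_pmf.expectation ?p (\<lambda>E. 1 - exp (- (1 / k) * ?C E))"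
  proof (intro integral_mono int)
    fix E
    show "indicator {E. k < ?C E} E / 2 \<le> 1 - exp (- (1 / k) * ?C E)"
    proof (cases "k < ?C E")
      case True
      then have "exp (- (1 / k) * ?C E) \<le> exp (-1)" using k by (simp add: field_simps)
      then have "exp (- (1 / k) * ?C E) \<le> 1 / 2" using e by (rule order_trans)
      then show ?thesis using True by simp
    qed (use k in simp)
  qed
  also have "\<dots> = 1 - measure_pmf.expectation ?p (\<lambda>E. exp (- (1 / k) * ?C E))"
    using int by (subst Bochner_Integration.integral_diff) auto
  also have "\<dots> \<le> 1 - exp (- (1 / k) - \<rho> * w v)"
    using exp_le_component_laplace[OF w l _ \<rho> sub v] k by simp
  also have "\<dots> \<le> 1 / k + \<rho> * w v"
    using exp_ge_add_one_self[of "- (1 / k) - \<rho> * w v"] by linarith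
  finally show ?thesis by simp
qed

lemma component_eq:
  assumes "y \<in> component V E x"
  shows "component V E y = component V E x"
proof -
  let ?r = "{(a, b). {a, b} \<in> E}"
  have "sym (?r\<^sup>*)"
    by (intro sym_rtrancl symI) (auto simp: insert_commute)
  moreover have "(x, y) \<in> ?r\<^sup>*" using assms by (simp add: component_def)
  ultimately show ?thesis
    unfolding component_def by (auto dest: symD intro: rtrancl_trans)
qed

text \<open>
  On the event, every vertex of a largest component has a component larger than \<open>k\<close>, and there are
  more than \<open>k\<close> such vertices; Markov's inequality for their number gives the factor \<open>1 / k\<close>.
\<close>
lemma prob_max_component_size_gt_le:
  fixes p :: "'a set set pmf" and k :: real
  assumes V: "finite V" "V \<noteq> {}" and k: "0 < k"
  shows "measure_pmf.prob p {E. k < max_component_size V E}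
    \<le> (\<Sum>x\<in>V. measure_pmf.prob p {E. k < card (component V E x)}) / k"
proof -
  let ?B = "\<lambda>x. {E. k < card (component V E x)}"
  have "k * measure_pmf.prob p {E. k < max_component_size V E}
      = measure_pmf.expectation p (\<lambda>E. k * indicator {E. k < max_component_size V E} E)"
    by simp
  also have "\<dots> \<le> measure_pmf.expectation p (\<lambda>E. \<Sum>x\<in>V. indicator (?B x) E)"
  proof (intro integral_mono integrable_mult_right Bochner_Integration.integrable_sum
      integrable_real_indicator)
    fix E
    have nn: "0 \<le> (\<Sum>x\<in>V. indicator (?B x) E :: real)" by (simp add: sum_nonneg)
    show "k * indicator {E. k < max_component_size V E} E \<le> (\<Sum>x\<in>V. indicator (?B x) E)"
    proof (cases "k < max_component_size V E")
      case True
      have "max_component_size V E \<in> (\<lambda>x. card (component V E x)) ` V"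
        unfolding max_component_size_def using V by (intro Max_in) auto
      then obtain x where x: "x \<in> V" "k < card (component V E x)"
        using True by auto
      have sub: "component V E x \<subseteq> V" by (auto simp: component_def)
      have "k \<le> (\<Sum>y\<in>component V E x. 1 :: real)" using x by simp
      also have "\<dots> = (\<Sum>y\<in>component V E x. indicator (?B y) E)"
      proof (intro sum.cong refl)
        fix y assume "y \<in> component V E x"
        then have "component V E y = component V E x" by (rule component_eq)
        then show "1 = indicator (?B y) E" using x by simp
      qed
      also have "\<dots> \<le> (\<Sum>y\<in>V. indicator (?B y) E)"
        using V sub by (intro sum_mono2) auto
      finally show ?thesis using True by simp
    qed (use nn in simp)
  qed (auto simp: less_top[symmetric])
  also have "\<dots> = (\<Sum>x\<in>V. measure_pmf.prob p (?B x))"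
    by (subst Bochner_Integration.integral_sum)
      (auto simp: less_top[symmetric] intro!: integrable_real_indicator)
  finally show ?thesis using k by (simp add: field_simps)
qed

section \<open>The near-critical window\<close>

text \<open>
  The quadratic term comes from \<open>exp (- t) = (exp (- t / 2))\<^sup>2 \<ge> (1 - t / 2)\<^sup>2\<close>, where
  \<open>t \<le> 2\<close> makes \<open>1 - t / 2\<close> nonnegative before squaring. It supplies the curvature that keeps a critical model
  from having large components.
\<close>
lemma one_minus_exp_le:
  fixes h t :: real
  assumes "0 \<le> h" "0 \<le> t" "t \<le> 2"
  shows "1 - exp (- h - t) \<le> h + t - t\<^sup>2 / 4"
proof -
  have "(1 - t / 2)\<^sup>2 \<le> (exp (- t / 2))\<^sup>2"
    using assms exp_ge_add_one_self[of "- t / 2"] by (intro power_mono) auto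
  also have "\<dots> = exp (- t)"
    by (simp add: power2_eq_square flip: exp_add)
  finally have t: "1 - t + t\<^sup>2 / 4 \<le> exp (- t)"
    by (simp add: power2_eq_square field_simps)
  have "exp (- t) - exp (- h - t) = exp (- t) * (1 - exp (- h))"
    by (simp add: algebra_simps flip: exp_add)
  also have "\<dots> \<le> 1 * h"
    using assms exp_ge_add_one_self[of "- h"] by (intro mult_mono) auto
  finally show ?thesis using t by simp
qed

text \<open>
  The curvature term is a third moment. It is bounded below through \<open>w (w - 1)\<^sup>2 \<ge> 0\<close>, that is
  \<open>w\<^sup>3 \<ge> 2 w\<^sup>2 - w\<close>, which leaves \<open>\<Sum> w\<close> and \<open>\<Sum> w\<^sup>2\<close> only. The coefficient of \<open>\<Sum> w\<^sup>2\<close> is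
  nonnegative as \<open>\<rho> \<le> 2\<close>, so an upper bound on the second moment can be inserted. In \<open>gain\<close>, the
  curvature \<open>\<rho>\<^sup>2 / 4\<close> has to pay both for \<open>h\<close> and for the excess \<open>e\<close> over criticality.
\<close>
lemma near_critical_subsolution:
  fixes w :: "'a \<Rightarrow> real" and h \<rho> e :: real
  assumes w: "\<And>j. j \<in> V \<Longrightarrow> 0 \<le> w j \<and> \<rho> * w j \<le> 1"
    and h: "0 \<le> h" and \<rho>: "0 \<le> \<rho>" "\<rho> \<le> 2" and e: "0 \<le> e"
    and sq: "(\<Sum>j\<in>V. (w j)\<^sup>2) \<le> (\<Sum>j\<in>V. w j) + e"
    and gain: "h * (\<Sum>j\<in>V. w j) + \<rho> * e \<le> \<rho>\<^sup>2 / 4 * (\<Sum>j\<in>V. w j)"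
  shows "(\<Sum>j\<in>V. w j * (1 - exp (- h - \<rho> * w j))) \<le> \<rho> * (\<Sum>j\<in>V. w j)"
proof -
  define l where "l = (\<Sum>j\<in>V. w j)"
  have "(\<Sum>j\<in>V. w j * (1 - exp (- h - \<rho> * w j)))
      \<le> (\<Sum>j\<in>V. (h + \<rho>\<^sup>2 / 4) * w j + (\<rho> - \<rho>\<^sup>2 / 2) * (w j)\<^sup>2)"
  proof (rule sum_mono)
    fix j assume "j \<in> V"
    then have j: "0 \<le> w j" "\<rho> * w j \<le> 1" using w by auto
    then have "w j * (1 - exp (- h - \<rho> * w j)) \<le> w j * (h + \<rho> * w j - (\<rho> * w j)\<^sup>2 / 4)"
      using h \<rho> by (intro mult_left_mono one_minus_exp_le) auto
    also have "\<dots> = (h + \<rho>\<^sup>2 / 4) * w j + (\<rho> - \<rho>\<^sup>2 / 2) * (w j)\<^sup>2 - \<rho>\<^sup>2 / 4 * (w j * (w j - 1)\<^sup>2)"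
      by (simp add: power2_eq_square algebra_simps)
    also have "\<dots> \<le> (h + \<rho>\<^sup>2 / 4) * w j + (\<rho> - \<rho>\<^sup>2 / 2) * (w j)\<^sup>2"
      using j by simp
    finally show "w j * (1 - exp (- h - \<rho> * w j)) \<le> \<dots>" .
  qed
  also have "\<dots> = (h + \<rho>\<^sup>2 / 4) * l + (\<rho> - \<rho>\<^sup>2 / 2) * (\<Sum>j\<in>V. (w j)\<^sup>2)"
    by (simp add: sum.distrib sum_distrib_left l_def)
  also have "\<dots> \<le> (h + \<rho>\<^sup>2 / 4) * l + (\<rho> - \<rho>\<^sup>2 / 2) * (l + e)"
  proof -
    have "0 \<le> \<rho> * (2 - \<rho>)" using \<rho> by simp
    then have "0 \<le> \<rho> - \<rho>\<^sup>2 / 2" by (simp add: power2_eq_square algebra_simps)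
    then show ?thesis using sq by (intro add_left_mono mult_left_mono) (auto simp: l_def)
  qed
  also have "\<dots> = \<rho> * l + (h * l + \<rho> * e - \<rho>\<^sup>2 / 4 * l) - \<rho>\<^sup>2 / 2 * e"
    by (simp add: algebra_simps)
  also have "\<dots> \<le> \<rho> * l"
  proof -
    have "0 \<le> \<rho>\<^sup>2 / 2 * e" using e by simp
    then show ?thesis using gain unfolding l_def by linarith
  qed
  finally show ?thesis by (simp add: l_def)
qed

text \<open>
  The choice \<open>h = 1 / k\<close>, \<open>\<rho> = 3 / sqrt k\<close> makes the curvature \<open>\<rho>\<^sup>2 / 4 = 9 / (4 k)\<close> larger than \<open>h\<close>,
  with room for the excess \<open>e\<close>.
\<close>
lemma norros_reittu_near_critical:
  fixes w :: "nat \<Rightarrow> real" and k e :: real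
  assumes w: "\<And>j. j \<in> {1..n} \<Longrightarrow> 0 \<le> w j \<and> 3 * w j \<le> sqrt k"
    and l: "0 < (\<Sum>j=1..n. w j)" "(\<Sum>j=1..n. w j) \<le> n"
    and k: "9 \<le> k" and e: "0 \<le> e"
    and sq: "(\<Sum>j=1..n. (w j)\<^sup>2) \<le> (\<Sum>j=1..n. w j) + e"
    and gain: "3 * e * sqrt k \<le> (\<Sum>j=1..n. w j)"
  shows "measure_pmf.prob (norros_reittu n w) {E. k < max_component_size {1..n} E}
    \<le> 8 * real n / (k * sqrt k)"
proof -
  define s where "s = sqrt k"
  have k_s: "k = s\<^sup>2" using k by (simp add: s_def)
  have s: "3 \<le> s" using k real_le_rsqrt[of 3 k] by (simp add: s_def)
  let ?l = "\<Sum>j=1..n. w j"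
  have "1 / k * ?l + 3 / s * e = (?l + e * 3 * s) / s\<^sup>2"
    using s by (simp add: k_s field_simps power2_eq_square)
  also have "\<dots> \<le> (9 / 4 * ?l) / s\<^sup>2"
    using gain l by (intro divide_right_mono) (auto simp: s_def)
  also have "\<dots> = (3 / s)\<^sup>2 / 4 * ?l"
    by (simp add: power_divide)
  finally have gain': "1 / k * ?l + 3 / s * e \<le> (3 / s)\<^sup>2 / 4 * ?l" .
  have w': "0 \<le> w j \<and> 3 / s * w j \<le> 1" if "j \<in> {1..n}" for j
    using w[OF that, folded s_def] s by (simp add: field_simps)
  have "3 / s \<le> 2" using s by (simp add: divide_le_eq)
  then have sub: "(\<Sum>j=1..n. w j * (1 - exp (- (1 / k) - 3 / s * w j))) \<le> 3 / s * ?l"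
    using s k by (intro near_critical_subsolution[OF w' _ _ _ e sq gain']) auto
  have n: "n \<noteq> 0" using l by (intro notI) simp
  have "measure_pmf.prob (norros_reittu n w) {E. k < max_component_size {1..n} E}
      \<le> (\<Sum>v=1..n. measure_pmf.prob (norros_reittu n w) {E. k < card (component {1..n} E v)}) / k"
    using n k by (intro prob_max_component_size_gt_le) auto
  also have "\<dots> \<le> (\<Sum>v=1..n. 2 * (1 / k + 3 / s * w v)) / k"
    using w l s k by (intro divide_right_mono sum_mono prob_component_gt_le[OF _ _ _ _ sub]) auto
  also have "(\<Sum>v=1..n. 2 * (1 / k + 3 / s * w v)) = 2 * (n / k + 3 / s * ?l)"
    by (simp add: sum.distrib sum_distrib_left)
  also have "\<dots> / k \<le> 2 * (n / s + 3 / s * n) / k"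
  proof -
    have "s * 1 \<le> s * s" using s by (intro mult_left_mono) auto
    then have "n / k \<le> n / s"
      using s k by (intro divide_left_mono) (auto simp: k_s power2_eq_square)
    moreover have "3 / s * ?l \<le> 3 / s * n" using l s by (intro mult_left_mono) auto
    ultimately have "n / k + 3 / s * ?l \<le> n / s + 3 / s * n" by (rule add_mono)
    then show ?thesis using k by (intro divide_right_mono mult_left_mono) auto
  qed
  also have "\<dots> = 8 * real n / (k * sqrt k)"
    using s k by (simp add: s_def[symmetric] field_simps)
  finally show ?thesis .
qed

text \<open>
  With \<open>a = 1 / (\<tau> - 1)\<close> this is where \<open>\<tau> > 4\<close> is needed: the largest weight is of smaller order
  than \<open>n powr (1 / 3)\<close>.
\<close>
lemma eventually_mult_powr_le_sqrt:
  fixes A c a :: real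
  assumes A: "1 < A" and c: "0 < c" and a: "a < 1 / 3"
  shows "\<forall>\<^sub>F n in sequentially. 3 * (c * real n) powr a \<le> sqrt (A * real n powr (2 / 3))"
proof -
  define b where "b = 1 / 3 - a"
  have "0 < b" using a by (simp add: b_def)
  then have "\<forall>\<^sub>F n in sequentially. 3 * c powr a \<le> real n powr b"
    by real_asymp
  with eventually_gt_at_top[of 0] show ?thesis
  proof eventually_elim
    case (elim n)
    have "3 * (c * real n) powr a = (3 * c powr a) * real n powr a"
      using c by (simp add: powr_mult)
    also have "\<dots> \<le> real n powr b * real n powr a"
      using elim by (intro mult_right_mono) auto
    also have "\<dots> = sqrt (real n powr (2 / 3))"
      by (simp add: powr_add[symmetric] powr_half_sqrt[symmetric] powr_powr b_def)
    also have "\<dots> \<le> sqrt (A * real n powr (2 / 3))"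
      using mult_right_mono[of 1 A "real n powr (2 / 3)"] A by simp
    finally show ?case .
  qed
qed

theorem proposition2p4:
  fixes c\<^sub>F \<tau> :: real
  assumes "c\<^sub>F > 0" and "\<tau> > 4"
  shows "\<exists>c\<^sub>3 > 0. \<forall>\<mu> :: real measure.
    real_distribution \<mu> \<longrightarrow>
    (AE x in \<mu>. x > 0) \<longrightarrow>
    (\<forall>x > 0. 1 - cdf \<mu> x \<le> c\<^sub>F * x powr (- (\<tau> - 1))) \<longrightarrow>
    (\<integral>x. x\<^sup>2 \<partial>\<mu>) / (\<integral>x. x \<partial>\<mu>) = 1 \<longrightarrow>
    (\<forall>A > 1. \<forall>\<^sub>F n in sequentially.
       measure_pmf.prob (norros_reittu n (quantile_weight (cdf \<mu>) n))
         {E. int (max_component_size {1..n} E) > \<lceil>A * real n powr (2 / 3)\<rceil>}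
       \<le> c\<^sub>3 / A powr (3 / 2))"
proof (intro exI[of _ 8] conjI allI impI)
  fix \<mu> :: "real measure" and A :: real
  assume "real_distribution \<mu>" and pos: "AE x in \<mu>. x > 0"
    and tail: "\<forall>x > 0. 1 - cdf \<mu> x \<le> c\<^sub>F * x powr (- (\<tau> - 1))"
    and crit: "(\<integral>x. x\<^sup>2 \<partial>\<mu>) / (\<integral>x. x \<partial>\<mu>) = 1" and A: "1 < A"
  interpret real_distribution \<mu> by fact
  define m where "m = (\<integral>x. x \<partial>\<mu>)"
  have m0: "m \<noteq> 0" and m2: "(\<integral>x. x\<^sup>2 \<partial>\<mu>) = m"
    using crit by (auto simp: m_def)
  \<comment> \<open>A non-integrable function has integral \<open>0\<close>, so criticality forces both moments to exist.\<close>
  have int: "integrable \<mu> (\<lambda>x. x)" "integrable \<mu> (\<lambda>x. x\<^sup>2)"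
    using m0 m2 not_integrable_integral_eq m_def by metis+
  have "0 \<le> m"
    unfolding m_def using pos by (intro integral_nonneg_AE) (auto elim!: eventually_mono)
  then have m_pos: "0 < m" using m0 by simp
  \<comment> \<open>\<open>m \<le> 1\<close> makes the constant independent of the distribution.\<close>
  have "0 \<le> (\<integral>x. (x - 1)\<^sup>2 \<partial>\<mu>)" by simp
  also have "\<dots> = (\<integral>x. x\<^sup>2 - 2 * x + 1 \<partial>\<mu>)"
    by (simp add: power2_eq_square algebra_simps)
  also have "\<dots> = (\<integral>x. x\<^sup>2 \<partial>\<mu>) - 2 * (\<integral>x. x \<partial>\<mu>) + 1"
    using int prob_space by simp
  finally have m_le: "m \<le> 1" unfolding m2 m_def[symmetric] by simp
  let ?w = "quantile_weight (cdf \<mu>)"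
  let ?k = "\<lambda>n::nat. A * real n powr (2 / 3)"
  let ?e = "\<lambda>n::nat. sqrt n * (1 + m)"
  have w_le: "?w n j \<le> (c\<^sub>F * n) powr (1 / (\<tau> - 1))" if n: "0 < n" and j: "j \<in> {1..n}" for n j
  proof -
    \<comment> \<open>The level at which the tail bound equals \<open>1 / n\<close>.\<close>
    let ?x = "(c\<^sub>F * n) powr (1 / (\<tau> - 1))"
    have x: "0 < ?x" using assms n by simp
    have "1 - cdf \<mu> ?x \<le> c\<^sub>F * ?x powr (- (\<tau> - 1))" using tail x by blast
    also have "?x powr (- (\<tau> - 1)) = (c\<^sub>F * n) powr (- 1)"
    proof -
      have "1 / (\<tau> - 1) * - (\<tau> - 1) = - 1" using assms by (simp only: mult_minus_right) simp
      then show ?thesis by (simp only: powr_powr)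
    qed
    also have "c\<^sub>F * (c\<^sub>F * n) powr (- 1) = 1 / n"
    proof -
      have "(c\<^sub>F * n) powr (- 1) = 1 / (c\<^sub>F * n)"
        using assms by (simp only: powr_minus_divide powr_one zero_le_mult_iff) simp
      then show ?thesis using assms n by simp
    qed
    also have "\<dots> \<le> real j / real n"
      using j by (intro divide_right_mono) auto
    finally show ?thesis
      unfolding quantile_weight_def by (rule tail_inverse_le[OF x])
  qed
  have ev1: "\<forall>\<^sub>F n in sequentially. 9 \<le> ?k n"
    using A by real_asymp
  have ev2: "\<forall>\<^sub>F n in sequentially. 3 * (c\<^sub>F * real n) powr (1 / (\<tau> - 1)) \<le> sqrt (?k n)"
    using assms A by (intro eventually_mult_powr_le_sqrt) (auto simp: field_simps)
  have ev3: "\<forall>\<^sub>F n in sequentially. 3 * ?e n * sqrt (?k n) + ?e n \<le> real n * m"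
    using A m_pos by real_asymp
  show "\<forall>\<^sub>F n in sequentially.
       measure_pmf.prob (norros_reittu n (?w n))
         {E. int (max_component_size {1..n} E) > \<lceil>?k n\<rceil>} \<le> 8 / A powr (3 / 2)"
    using eventually_gt_at_top[of "0 :: nat"] ev1 ev2 ev3
  proof eventually_elim
    case (elim n)
    let ?l = "\<Sum>j=1..n. ?w n j"
    have l: "real n * m \<le> ?l + ?e n"
      using mean_le_sum_quantile_weight[OF pos elim(1) int] m2 by (simp add: m_def)
    have e_pos: "0 < ?e n" using elim m_pos by simp
    moreover have "0 < sqrt (?k n)" using elim by simp
    ultimately have "0 < 3 * ?e n * sqrt (?k n)" by simp
    then have l_pos: "0 < ?l" using l elim by linarith
    have "?l \<le> n * m" using sum_quantile_weight_le[OF pos elim(1) int(1)] by (simp add: m_def)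
    also have "\<dots> \<le> real n * 1" using m_le by (intro mult_left_mono) auto
    finally have l_le: "?l \<le> n" by simp
    have "(\<Sum>j=1..n. (?w n j)\<^sup>2) \<le> n * m"
      using sum_quantile_weight_square_le[OF pos elim(1) int(2)] m2 by simp
    then have sq: "(\<Sum>j=1..n. (?w n j)\<^sup>2) \<le> ?l + ?e n" using l by linarith
    have w: "0 \<le> ?w n j \<and> 3 * ?w n j \<le> sqrt (?k n)" if "j \<in> {1..n}" for j
      using w_le[OF elim(1) that] quantile_weight_nonneg[OF that] elim(3) by linarith
    have "measure_pmf.prob (norros_reittu n (?w n)) {E. int (max_component_size {1..n} E) > \<lceil>?k n\<rceil>}
        \<le> measure_pmf.prob (norros_reittu n (?w n)) {E. ?k n < max_component_size {1..n} E}"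
    proof (rule measure_pmf.finite_measure_mono)
      have "?k n < real N" if "\<lceil>?k n\<rceil> < int N" for N
        using that by linarith
      then show "{E. int (max_component_size {1..n} E) > \<lceil>?k n\<rceil>}
          \<subseteq> {E. ?k n < max_component_size {1..n} E}"
        by blast
    qed simp
    also have "\<dots> \<le> 8 * real n / (?k n * sqrt (?k n))"
      using elim l e_pos
      by (intro norros_reittu_near_critical[OF w l_pos l_le _ _ sq]) auto
    also have "?k n * sqrt (?k n) = ?k n powr (3 / 2)"
    proof -
      have "?k n powr (1 + 1 / 2) = ?k n * sqrt (?k n)"
        using elim unfolding powr_add by (simp add: powr_half_sqrt)
      then show ?thesis by simp
    qed
    also have "\<dots> = A powr (3 / 2) * n"
      using A elim by (simp add: powr_mult powr_powr)
    also have "8 * real n / \<dots> = 8 / A powr (3 / 2)"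
      using elim by simp
    finally show ?case .
  qed
qed simp

end
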